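(* Let $r\ge 1$ be an integer, let $P:\mathbb R\to\mathbb R$ satisfy the initial assumptions (A1)--(A3) of the context, and let $\lambda:\Gamma\times\mathbb R\to[0,\infty)$, where $\Gamma=PGL_2(\mathbb Z)$, satisfy the compatibility condition (C) and Properties (1), (2), (3) of the context. Then the function $$T(x)=\sum_{\gamma\in\Gamma}\lambda(\gamma,x)\,\bigl(\varepsilon_\gamma P^\gamma\bigr)_+(x)$$ is well defined (the series of nonnegative terms converges for every $x\in\mathbb R$), even, $1$-periodic and continuous on $\mathbb R$, and it satisfies the functional equation $$x^{2r}\,T\!\left(\frac1x\right)-T(x)=-R_\lambda(x),\qquad x\neq 0,$$ where $$R_\lambda(x):=\sum_{\substack{\gamma\in\Gamma\\ (\varepsilon_\gamma P^\gamma)_+(0)>0}}\lambda(\gamma,x)\,\varepsilon_\gamma P^\gamma(x).$$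
   Context: Initial assumptions on $P$ (for a fixed integer $r\ge1$): (A1) $P:\mathbb R\to\mathbb R$ is continuous and piecewise polynomial, with each polynomial piece of degree at most $2r$. (A2) $P$ has exactly two real roots $\alpha<\beta$, both irrational, with $P(x)>0$ for $x\in(\alpha,\beta)$ and $P(x)<0$ for $x\notin[\alpha,\beta]$. (A3) There exists $L<0$ such that $\lim_{x\to-\infty}P(x)/x^{2r}=\lim_{x\to+\infty}P(x)/x^{2r}=L$. Action. For $\gamma=\begin{pmatrix}a&b\\c&d\end{pmatrix}\in\Gamma=PGL_2(\mathbb Z)$ (acting by Möbius transformations $\gamma x=\frac{ax+b}{cx+d}$), put $P^\gamma(x)=(cx+d)^{2r}P\left(\frac{ax+b}{cx+d}\right)$, with the value at the pole $x=-d/c$ (if $c\ne0$) defined by continuity (the limit exists by (A3)). Write $P^\gamma(\infty)$ for $\lim_{x\to\pm\infty}P^\gamma(x)/x^{2r}$ (the "leading coefficient", nonzero because the roots of $P$ are irrational), and let $\varepsilon_\gamma=1$ if $P^\gamma(\infty)<0$ and $\varepsilon_\gamma=-1$ if $P^\gamma(\infty)>0$. Let $\Gamma_P=\{\gamma\in\Gamma:\varepsilon_\gamma P^\gamma\equiv P\}$, a subgroup of $\Gamma$; the function $\varepsilon_\gamma P^\gamma$ depends only on the coset $\Gamma_P\gamma\in\Gamma_P\backslash\Gamma$. For a real-valued function $Q$, $Q_+(x):=\max\{Q(x),0\}$. Let $\mathsf T(x)=x+1$, $V(x)=-x$, $U(x)=1/x$, regarded as elements of $\Gamma$. Conditions on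 the weights $\lambda(\gamma,x)\ge0$: (C) For every $\sigma\in\{\mathsf T,V,U\}$ and $\gamma\in\Gamma$: $\lambda(\gamma\sigma^{-1},\sigma x)=\lambda(\gamma,x)$ for all $x$ with $x,\sigma x\in\mathbb R$. (1) For every $\gamma\in\Gamma$, the function $x\mapsto\lambda(\gamma,x)\varepsilon_\gamma P^\gamma(x)$ is continuous on $\mathbb R$. (2) For every $\gamma\in\Gamma$, the sum $\sum_{\delta\in\Gamma_P}\lambda(\delta\gamma,x)\,|P^\gamma(x)|$ converges locally uniformly in $x\in\mathbb R$. (3) There are only finitely many cosets $\Gamma_P\gamma\in\Gamma_P\backslash\Gamma$ such that $\varepsilon_\gamma P^\gamma(0)>0$. Sums over $\Gamma$ are unordered sums. *)

theory Defs
  imports "HOL-Analysis.Analysis" "HOL-Computational_Algebra.Polynomial"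
begin

text \<open>Over the integers, \<open>invertible\<close> asks for an integer inverse, so the domain of this
  partial equivalence is $GL_2(\mathbb{Z})$ and the quotient by it is $PGL_2(\mathbb{Z})$.\<close>

definition pgl2_rel :: "int^2^2 \<Rightarrow> int^2^2 \<Rightarrow> bool" where
  "pgl2_rel A B \<longleftrightarrow> invertible A \<and> (B = A \<or> B = - A)"

lemma neg_matrix_mult:
  fixes A B :: "int^2^2"
  shows "(- A) ** B = - (A ** B)" "A ** (- B) = - (A ** B)"
  by (simp_all add: matrix_matrix_mult_def vec_eq_iff sum_negf)

lemma invertible_uminus:
  fixes A :: "int^2^2"
  shows "invertible (- A) \<longleftrightarrow> invertible A"
proof -
  have "invertible (- A)" if "invertible A" for A :: "int^2^2"
  proof -
    from that obtain B where "A ** B = mat 1" "B ** A = mat 1"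
      unfolding invertible_def by blast
    then show ?thesis
      unfolding invertible_def by (intro exI[of _ "- B"]) (simp add: neg_matrix_mult)
  qed
  from this[of A] this[of "- A"] show ?thesis by auto
qed

lemma matrix_inv_both:
  fixes A :: "int^2^2"
  assumes "invertible A"
  shows "A ** matrix_inv A = mat 1" "matrix_inv A ** A = mat 1"
  using someI_ex[OF assms[unfolded invertible_def]] unfolding matrix_inv_def by auto

lemma matrix_inv_eqI:
  fixes A B :: "int^2^2"
  assumes "A ** B = mat 1" "B ** A = mat 1"
  shows "matrix_inv A = B"
proof -
  have "invertible A" using assms unfolding invertible_def by blast
  then have "matrix_inv A = matrix_inv A ** (A ** B)" using assms by simp
  also have "\<dots> = B"
    by (simp add: matrix_mul_assoc matrix_inv_both \<open>invertible A\<close>)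
  finally show ?thesis .
qed

lemma invertible_matrix_inv:
  fixes A :: "int^2^2"
  assumes "invertible A"
  shows "invertible (matrix_inv A)"
  using matrix_inv_both[OF assms] unfolding invertible_def by blast

lemma matrix_inv_uminus:
  fixes A :: "int^2^2"
  assumes "invertible A"
  shows "matrix_inv (- A) = - matrix_inv A"
  by (rule matrix_inv_eqI) (simp_all add: neg_matrix_mult matrix_inv_both assms)

lemma part_equivp_pgl2_rel: "part_equivp pgl2_rel"
proof (rule part_equivpI)
  have "invertible (mat 1 :: int^2^2)"
    unfolding invertible_def by (intro exI[of _ "mat 1"]) simp
  then show "\<exists>A. pgl2_rel A A" by (auto simp: pgl2_rel_def)
  show "symp pgl2_rel"
    by (auto simp: symp_def pgl2_rel_def invertible_uminus)
  show "transp pgl2_rel"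
    by (auto simp: transp_def pgl2_rel_def)
qed

quotient_type pgl2z = "int^2^2" / partial: pgl2_rel
  by (rule part_equivp_pgl2_rel)

instantiation pgl2z :: "{monoid_mult, inverse}"
begin

lift_definition one_pgl2z :: pgl2z is "mat 1"
  unfolding pgl2_rel_def invertible_def by (auto intro!: exI[of _ "mat 1"])

lift_definition times_pgl2z :: "pgl2z \<Rightarrow> pgl2z \<Rightarrow> pgl2z" is "(**)"
  by (auto simp: pgl2_rel_def neg_matrix_mult invertible_mult)

lift_definition inverse_pgl2z :: "pgl2z \<Rightarrow> pgl2z" is matrix_inv
  by (auto simp: pgl2_rel_def invertible_matrix_inv matrix_inv_uminus)

definition divide_pgl2z :: "pgl2z \<Rightarrow> pgl2z \<Rightarrow> pgl2z" where
  "divide_pgl2z g h = g * inverse h"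

instance
proof
  fix a b c :: pgl2z
  show "a * b * c = a * (b * c)"
    by transfer (auto simp: pgl2_rel_def matrix_mul_assoc intro: invertible_mult)
  show "1 * a = a" by transfer (auto simp: pgl2_rel_def)
  show "a * 1 = a" by transfer (auto simp: pgl2_rel_def)
qed

end

lemma pgl2z_left_inverse: "inverse g * g = 1" for g :: pgl2z
  by transfer
     (auto simp: pgl2_rel_def matrix_inv_both invertible_def intro!: exI[of _ "mat 1"])

lemma pgl2z_right_inverse: "g * inverse g = 1" for g :: pgl2z
  by transfer
     (auto simp: pgl2_rel_def matrix_inv_both invertible_def intro!: exI[of _ "mat 1"])

definition moeb_num :: "int^2^2 \<Rightarrow> real \<Rightarrow> real" where
  "moeb_num A x = of_int (A$1$1) * x + of_int (A$1$2)"

definition moeb_den :: "int^2^2 \<Rightarrow> real \<Rightarrow> real" where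
  "moeb_den A x = of_int (A$2$1) * x + of_int (A$2$2)"

lemma moeb_uminus [simp]:
  "moeb_num (- A) x = - moeb_num A x" "moeb_den (- A) x = - moeb_den A x"
  by (simp_all add: moeb_num_def moeb_den_def)

lift_definition moebius_map :: "pgl2z \<Rightarrow> real \<Rightarrow> real" is
  "\<lambda>A x. moeb_num A x / moeb_den A x"
  by (auto simp: pgl2_rel_def)

text \<open>\<open>maps_to_infinity g x\<close> says that the image of the real number \<open>x\<close> under \<open>g\<close> is the point
  at infinity of the projective line; \<open>moebius_map g x\<close> is meaningful only where it fails.\<close>

lift_definition maps_to_infinity :: "pgl2z \<Rightarrow> real \<Rightarrow> bool" is
  "\<lambda>A x. moeb_den A x = 0"
  by (auto simp: pgl2_rel_def)

lift_definition translation_elt :: pgl2z is "vector [vector [1, 1], vector [0, 1]] :: int^2^2"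
  unfolding pgl2_rel_def invertible_def
  by (auto intro!: exI[of _ "vector [vector [1, -1], vector [0, 1]] :: int^2^2"]
      simp: matrix_matrix_mult_def mat_def vec_eq_iff forall_2 sum_2)

lift_definition negation_elt :: pgl2z is "vector [vector [-1, 0], vector [0, 1]] :: int^2^2"
  unfolding pgl2_rel_def invertible_def
  by (auto intro!: exI[of _ "vector [vector [-1, 0], vector [0, 1]] :: int^2^2"]
      simp: matrix_matrix_mult_def mat_def vec_eq_iff forall_2 sum_2)

lift_definition inversion_elt :: pgl2z is "vector [vector [0, 1], vector [1, 0]] :: int^2^2"
  unfolding pgl2_rel_def invertible_def
  by (auto intro!: exI[of _ "vector [vector [0, 1], vector [1, 0]] :: int^2^2"]
      simp: matrix_matrix_mult_def mat_def vec_eq_iff forall_2 sum_2)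

lemma moebius_generators:
  "moebius_map translation_elt x = x + 1" "\<not> maps_to_infinity translation_elt x"
  "moebius_map negation_elt x = - x" "\<not> maps_to_infinity negation_elt x"
  "moebius_map inversion_elt x = 1 / x" "maps_to_infinity inversion_elt x \<longleftrightarrow> x = 0"
  by (transfer, simp add: moeb_num_def moeb_den_def)+

text \<open>The pieces are the finitely many open intervals cut out by the breakpoints \<open>B\<close>.\<close>

definition piecewise_poly :: "nat \<Rightarrow> (real \<Rightarrow> real) \<Rightarrow> bool" where
  "piecewise_poly n P \<longleftrightarrow>
     (\<exists>B. finite B \<and>
       (\<forall>I\<in>components (- B). \<exists>p. degree p \<le> n \<and> (\<forall>x\<in>I. P x = poly p x)))"

text \<open>\<open>slash r P g\<close> is $P^\gamma$ of weight $2r$. At the pole it is the limit of the values at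
  nearby points; evenness of the weight makes the formula independent of the sign of the matrix.\<close>

lift_definition slash :: "nat \<Rightarrow> (real \<Rightarrow> real) \<Rightarrow> pgl2z \<Rightarrow> real \<Rightarrow> real" is
  "\<lambda>r P A x.
     if moeb_den A x = 0
     then Lim (at x) (\<lambda>y. moeb_den A y ^ (2 * r) * P (moeb_num A y / moeb_den A y))
     else moeb_den A x ^ (2 * r) * P (moeb_num A x / moeb_den A x)"
  by (auto simp: pgl2_rel_def)

text \<open>On the reals the filter \<open>at_infinity\<close> covers both $x \to +\infty$ and $x \to -\infty$.\<close>

definition slash_infty :: "nat \<Rightarrow> (real \<Rightarrow> real) \<Rightarrow> pgl2z \<Rightarrow> real" where
  "slash_infty r P g = Lim at_infinity (\<lambda>x. slash r P g x / x ^ (2 * r))"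

text \<open>The value \<open>slash_infty r P g\<close> is nonzero whenever \<open>P\<close> has only irrational roots and
  the same nonzero leading coefficient at both ends.\<close>

definition slash_sign :: "nat \<Rightarrow> (real \<Rightarrow> real) \<Rightarrow> pgl2z \<Rightarrow> real" where
  "slash_sign r P g = (if slash_infty r P g < 0 then 1 else - 1)"

definition signed_slash :: "nat \<Rightarrow> (real \<Rightarrow> real) \<Rightarrow> pgl2z \<Rightarrow> real \<Rightarrow> real" where
  "signed_slash r P g x = slash_sign r P g * slash r P g x"

definition stabiliser :: "nat \<Rightarrow> (real \<Rightarrow> real) \<Rightarrow> pgl2z set" where
  "stabiliser r P = {g. signed_slash r P g = P}"

definition stabiliser_coset :: "nat \<Rightarrow> (real \<Rightarrow> real) \<Rightarrow> pgl2z \<Rightarrow> pgl2z set" where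
  "stabiliser_coset r P g = (\<lambda>d. d * g) ` stabiliser r P"

definition pos_part :: "(real \<Rightarrow> real) \<Rightarrow> real \<Rightarrow> real" where
  "pos_part Q x = max (Q x) 0"

text \<open>The unordered series of the functions \<open>f i\<close> over \<open>i \<in> I\<close> converges locally uniformly:
  every point has a neighbourhood on which the net of finite partial sums converges uniformly.\<close>

definition locally_uniformly_summable :: "('i \<Rightarrow> real \<Rightarrow> real) \<Rightarrow> 'i set \<Rightarrow> bool" where
  "locally_uniformly_summable f I \<longleftrightarrow>
     (\<exists>S. \<forall>x. \<exists>e>0. uniform_limit (ball x e) (\<lambda>F y. \<Sum>i\<in>F. f i y) S
                      (finite_subsets_at_top I))"

definition weighted_sum ::
    "nat \<Rightarrow> (real \<Rightarrow> real) \<Rightarrow> (pgl2z \<Rightarrow> real \<Rightarrow> real) \<Rightarrow> real \<Rightarrow> real" where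
  "weighted_sum r P lam x = (\<Sum>\<^sub>\<infinity>g. lam g x * pos_part (signed_slash r P g) x)"

definition positive_at_zero :: "nat \<Rightarrow> (real \<Rightarrow> real) \<Rightarrow> pgl2z set" where
  "positive_at_zero r P = {g. pos_part (signed_slash r P g) 0 > 0}"

definition remainder_sum ::
    "nat \<Rightarrow> (real \<Rightarrow> real) \<Rightarrow> (pgl2z \<Rightarrow> real \<Rightarrow> real) \<Rightarrow> real \<Rightarrow> real" where
  "remainder_sum r P lam x =
     (\<Sum>\<^sub>\<infinity>g\<in>positive_at_zero r P. lam g x * signed_slash r P g x)"

end

theory Submission
  imports Defs
begin

text \<open>
  Let \<open>F(u, w) = w\<^sup>2\<^sup>r P(u/w)\<close> be the homogeneous form of \<open>P\<close>, completed by \<open>F(u, 0) = L u\<^sup>2\<^sup>r\<close>. It is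
  continuous away from the origin and has no zero at a nonzero integer vector, and
  \<open>P\<^sup>\<gamma>(x) = F(\<gamma>(x, 1))\<close>, \<open>P\<^sup>\<gamma>(\<infinity>) = F(\<gamma>(1, 0))\<close>. So the sum \<open>T\<close> picks out those \<open>\<gamma>\<close> for which
  \<open>F \<circ> \<gamma>\<close> has opposite signs at the cusp \<open>(1, 0)\<close> and at \<open>(x, 1)\<close>. Let the cusp vary: for an
  integer vector \<open>v\<close>, let \<open>t(\<gamma>, v, x)\<close> be \<open>\<lambda>(\<gamma>, x) |P\<^sup>\<gamma>(x)|\<close> if \<open>F(\<gamma> v)\<close> and \<open>P\<^sup>\<gamma>(x)\<close> have opposite
  signs and \<open>0\<close> otherwise (\<open>term_at\<close>). By the compatibility of \<open>\<lambda>\<close>, replacing \<open>\<gamma>\<close> by \<open>\<gamma> \<sigma>\<close> in \<open>t\<close>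
  amounts, up to the factor of weight \<open>2r\<close>, to moving \<open>v\<close> and \<open>x\<close> by \<open>\<sigma>\<close>.
  Translation and negation fix the cusp \<open>(1, 0)\<close>, whence periodicity and evenness of \<open>T\<close>;
  inversion exchanges it with \<open>(0, 1)\<close>. Moving the cusp from \<open>(1, 0)\<close> to \<open>(0, 1)\<close> alters only the
  terms in which \<open>F \<circ> \<gamma>\<close> changes sign between the two, and these are the terms of \<open>R\<close>
  (\<open>term_at_zero\<close>). This is the functional equation, \<open>T(x) = x\<^sup>2\<^sup>r T(1/x) + R(x)\<close>.

  For convergence, note first that by Properties (2) and (3) the absolute sum of the terms of \<open>R\<close>
  is bounded by some \<open>C\<close> on \<open>[-1/2, 1/2]\<close>. The nearest-integer continued fraction of \<open>x\<close> alternates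
  translations into that interval with inversions. Along it the cusp of a finite partial
  sum moves through integer vectors \<open>(a, c)\<close> with \<open>|a - c x| \<le> 2\<^sup>-\<^sup>k\<close>, and the total cost of the moves
  is at most \<open>C + C/4 + C/16 + \<dots> \<le> 2 C\<close> because \<open>x\<^sup>2\<^sup>r \<le> 1/4\<close> at each inversion
  (\<open>finite_sum_descent\<close>). As \<open>a/c\<close> tends to \<open>x\<close>, the form \<open>F \<circ> \<gamma>\<close> has the same sign at \<open>(a, c)\<close> as at
  \<open>(x, 1)\<close> for each of the finitely many \<open>\<gamma>\<close> in the partial sum with \<open>P\<^sup>\<gamma>(x) \<noteq> 0\<close>. Nothing then remains of the moved
  sum, and every finite partial sum of \<open>T(x)\<close> is at most \<open>2 C\<close>.

  Continuity follows from boundedness, periodicity and the functional equation alone, given that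
  \<open>R\<close> is continuous and \<open>T(0) = R(0)\<close>. The oscillation of \<open>T\<close> at \<open>x\<close> is \<open>x\<^sup>2\<^sup>r\<close> times its oscillation
  at \<open>1/x\<close>, and \<open>x\<close> may be translated into \<open>[-1/2, 1/2]\<close>. So a uniform bound for the oscillation
  can be halved again and again, and the oscillation vanishes.
\<close>

section \<open>Sums with locally uniformly small tails\<close>

text \<open>For nonnegative \<open>h\<close>, a Cauchy criterion without reference to a limit function. Unlike locally uniform
  convergence in terms of a limit, it passes to subfamilies and finite unions of the index set at
  once, which is how the terms of the remainder are cut out of finitely many cosets.\<close>
definition small_tails :: "('i \<Rightarrow> real \<Rightarrow> real) \<Rightarrow> 'i set \<Rightarrow> bool" where
  "small_tails h J \<longleftrightarrow> (\<forall>x. \<forall>e>0. \<exists>F d. finite F \<and> F \<subseteq> J \<and> d > 0 \<and>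
     (\<forall>y\<in>ball x d. \<forall>G. finite G \<longrightarrow> G \<subseteq> J - F \<longrightarrow> (\<Sum>i\<in>G. h i y) \<le> e))"

lemma small_tailsE:
  assumes "small_tails h J" "e > 0"
  obtains F d where "finite F" "F \<subseteq> J" "d > 0"
    "\<And>y G. y \<in> ball x d \<Longrightarrow> finite G \<Longrightarrow> G \<subseteq> J - F \<Longrightarrow> (\<Sum>i\<in>G. h i y) \<le> e"
proof -
  from assms(1)[unfolded small_tails_def, rule_format, OF assms(2), of x]
  obtain F d where "finite F" "F \<subseteq> J" "d > 0"
    and tail: "\<forall>y\<in>ball x d. \<forall>G. finite G \<longrightarrow> G \<subseteq> J - F \<longrightarrow> (\<Sum>i\<in>G. h i y) \<le> e"
    by (elim exE conjE) (rule that, simp_all)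
  then show thesis
    using tail[rule_format] by (intro that)
qed

lemma locally_uniformly_summable_imp_small_tails:
  assumes "locally_uniformly_summable f I"
  shows "small_tails f I"
  unfolding small_tails_def
proof (intro allI impI)
  fix x e :: real assume e: "e > 0"
  from assms obtain S d where d: "d > 0"
    and S: "uniform_limit (ball x d) (\<lambda>F y. \<Sum>i\<in>F. f i y) S (finite_subsets_at_top I)"
    unfolding locally_uniformly_summable_def by blast
  have "\<forall>\<^sub>F F in finite_subsets_at_top I. \<forall>y\<in>ball x d. dist (\<Sum>i\<in>F. f i y) (S y) < e / 2"
    by (rule uniform_limitD[OF S]) (use e in simp)
  then obtain F where F: "finite F" "F \<subseteq> I"
    and close': "\<forall>G. finite G \<and> F \<subseteq> G \<and> G \<subseteq> I \<longrightarrow>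
      (\<forall>y\<in>ball x d. dist (\<Sum>i\<in>G. f i y) (S y) < e / 2)"
    unfolding eventually_finite_subsets_at_top by (elim exE conjE) (rule that)
  have close: "dist (\<Sum>i\<in>G. f i y) (S y) < e / 2"
    if "finite G" "F \<subseteq> G" "G \<subseteq> I" "y \<in> ball x d" for G y
    using close' that by blast
  have "(\<Sum>i\<in>G. f i y) \<le> e" if y: "y \<in> ball x d" and G: "finite G" "G \<subseteq> I - F" for y G
  proof -
    have "(\<Sum>i\<in>F \<union> G. f i y) = (\<Sum>i\<in>F. f i y) + (\<Sum>i\<in>G. f i y)"
      using F G by (intro sum.union_disjoint) auto
    moreover have "dist (\<Sum>i\<in>F \<union> G. f i y) (S y) < e / 2"
      using F G y by (intro close) auto
    moreover have "dist (\<Sum>i\<in>F. f i y) (S y) < e / 2"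
      using F y by (intro close) auto
    ultimately show ?thesis unfolding dist_real_def by linarith
  qed
  with F d show "\<exists>F d. finite F \<and> F \<subseteq> I \<and> d > 0 \<and>
     (\<forall>y\<in>ball x d. \<forall>G. finite G \<longrightarrow> G \<subseteq> I - F \<longrightarrow> (\<Sum>i\<in>G. f i y) \<le> e)"
    by blast
qed

lemma small_tails_image:
  assumes "small_tails (\<lambda>d. h (k d)) I" "inj_on k I"
  shows "small_tails h (k ` I)"
  unfolding small_tails_def
proof (intro allI impI)
  fix x e :: real assume "e > 0"
  with assms(1) obtain F d where F: "finite F" "F \<subseteq> I" "d > 0"
    and tail: "\<And>y G. y \<in> ball x d \<Longrightarrow> finite G \<Longrightarrow> G \<subseteq> I - F \<Longrightarrow> (\<Sum>i\<in>G. h (k i) y) \<le> e"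
    by (rule small_tailsE[where x = x]) blast
  have "(\<Sum>i\<in>G. h i y) \<le> e"
    if y: "y \<in> ball x d" and G: "finite G" "G \<subseteq> k ` I - k ` F" for y G
  proof -
    from G obtain H where H: "H \<subseteq> I" "finite H" "G = k ` H"
      using finite_subset_image[of G k I] by blast
    have "(\<Sum>i\<in>G. h i y) = (\<Sum>i\<in>H. h (k i) y)"
      using H inj_on_subset[OF assms(2)] by (simp add: sum.reindex)
    also have "\<dots> \<le> e" using H G y by (intro tail) auto
    finally show ?thesis .
  qed
  then have "\<forall>y\<in>ball x d. \<forall>G. finite G \<longrightarrow> G \<subseteq> k ` I - k ` F \<longrightarrow> (\<Sum>i\<in>G. h i y) \<le> e"
    by blast
  moreover have "finite (k ` F)" "k ` F \<subseteq> k ` I" using F by auto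
  ultimately show "\<exists>F d. finite F \<and> F \<subseteq> k ` I \<and> d > 0 \<and>
     (\<forall>y\<in>ball x d. \<forall>G. finite G \<longrightarrow> G \<subseteq> k ` I - F \<longrightarrow> (\<Sum>i\<in>G. h i y) \<le> e)"
    using F(3) by (intro exI[of _ "k ` F"] exI[of _ d] conjI)
qed

lemma small_tails_mono:
  assumes "small_tails h J" "I \<subseteq> J" "\<And>i x. i \<in> I \<Longrightarrow> h' i x \<le> h i x"
  shows "small_tails h' I"
  unfolding small_tails_def
proof (intro allI impI)
  fix x e :: real assume "e > 0"
  with assms(1) obtain F d where F: "finite F" "F \<subseteq> J" "d > 0"
    and tail: "\<And>y G. y \<in> ball x d \<Longrightarrow> finite G \<Longrightarrow> G \<subseteq> J - F \<Longrightarrow> (\<Sum>i\<in>G. h i y) \<le> e"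
    by (rule small_tailsE[where x = x]) blast
  show "\<exists>F d. finite F \<and> F \<subseteq> I \<and> d > 0 \<and>
     (\<forall>y\<in>ball x d. \<forall>G. finite G \<longrightarrow> G \<subseteq> I - F \<longrightarrow> (\<Sum>i\<in>G. h' i y) \<le> e)"
  proof (intro exI conjI ballI allI impI)
    show "finite (F \<inter> I)" "F \<inter> I \<subseteq> I" "d > 0" using F by auto
    fix y G assume "y \<in> ball x d" "finite G" "G \<subseteq> I - F \<inter> I"
    moreover from this assms(2) have "G \<subseteq> J - F" by blast
    ultimately have "(\<Sum>i\<in>G. h i y) \<le> e" by (intro tail)
    moreover have "(\<Sum>i\<in>G. h' i y) \<le> (\<Sum>i\<in>G. h i y)"
      using \<open>G \<subseteq> I - F \<inter> I\<close> by (intro sum_mono assms(3)) auto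
    ultimately show "(\<Sum>i\<in>G. h' i y) \<le> e" by linarith
  qed
qed

lemma small_tails_Un:
  assumes "small_tails h I" "small_tails h J"
  shows "small_tails h (I \<union> J)"
  unfolding small_tails_def
proof (intro allI impI)
  fix x e :: real assume e: "e > 0"
  then have e2: "e / 2 > 0" by simp
  obtain F1 d1 where F1: "finite F1" "F1 \<subseteq> I" "d1 > 0"
    and tail1: "\<And>y G. y \<in> ball x d1 \<Longrightarrow> finite G \<Longrightarrow> G \<subseteq> I - F1 \<Longrightarrow> (\<Sum>i\<in>G. h i y) \<le> e / 2"
    by (rule small_tailsE[OF assms(1) e2, where x = x]) blast
  obtain F2 d2 where F2: "finite F2" "F2 \<subseteq> J" "d2 > 0"
    and tail2: "\<And>y G. y \<in> ball x d2 \<Longrightarrow> finite G \<Longrightarrow> G \<subseteq> J - F2 \<Longrightarrow> (\<Sum>i\<in>G. h i y) \<le> e / 2"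
    by (rule small_tailsE[OF assms(2) e2, where x = x]) blast
  have "(\<Sum>i\<in>G. h i y) \<le> e"
    if y: "y \<in> ball x (min d1 d2)" and G: "finite G" "G \<subseteq> (I \<union> J) - (F1 \<union> F2)" for y G
  proof -
    have "(\<Sum>i\<in>G. h i y) = (\<Sum>i\<in>G \<inter> I. h i y) + (\<Sum>i\<in>G - I. h i y)"
      using G(1) by (rule sum.Int_Diff)
    also have "\<dots> \<le> e / 2 + e / 2"
      using y G by (intro add_mono tail1 tail2) auto
    finally show ?thesis by simp
  qed
  then have "\<forall>y\<in>ball x (min d1 d2). \<forall>G. finite G \<longrightarrow> G \<subseteq> (I \<union> J) - (F1 \<union> F2)
      \<longrightarrow> (\<Sum>i\<in>G. h i y) \<le> e"
    by blast
  moreover have "finite (F1 \<union> F2)" "F1 \<union> F2 \<subseteq> I \<union> J" "min d1 d2 > 0"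
    using F1 F2 by auto
  ultimately show "\<exists>F d. finite F \<and> F \<subseteq> I \<union> J \<and> d > 0 \<and>
     (\<forall>y\<in>ball x d. \<forall>G. finite G \<longrightarrow> G \<subseteq> (I \<union> J) - F \<longrightarrow> (\<Sum>i\<in>G. h i y) \<le> e)"
    by (intro exI[of _ "F1 \<union> F2"] exI[of _ "min d1 d2"] conjI)
qed

lemma small_tails_Union:
  assumes "finite \<C>" "\<And>J. J \<in> \<C> \<Longrightarrow> small_tails h J"
  shows "small_tails h (\<Union>\<C>)"
  using assms
proof (induction rule: finite_induct)
  case empty
  show ?case unfolding small_tails_def
    by (intro allI impI exI[of _ "{}"] exI[of _ 1]) auto
next
  case (insert J \<C>)
  then show ?case by (simp add: small_tails_Un)
qed

context
  fixes f :: "'i \<Rightarrow> real \<Rightarrow> real" and J :: "'i set"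
  assumes cont: "\<And>i. continuous_on UNIV (f i)"
    and tails: "small_tails (\<lambda>i y. \<bar>f i y\<bar>) J"
begin

text \<open>Near a point, all but finitely many terms contribute at most \<open>1\<close>, and the finitely many
  others are continuous.\<close>
lemma small_tails_bounded_locally:
  obtains d C where "d > 0" "C \<ge> 0"
    "\<And>y G. y \<in> ball x d \<Longrightarrow> finite G \<Longrightarrow> G \<subseteq> J \<Longrightarrow> (\<Sum>i\<in>G. \<bar>f i y\<bar>) \<le> C"
proof -
  obtain F d where F: "finite F" "F \<subseteq> J" "d > 0"
    and tail: "\<And>y G. y \<in> ball x d \<Longrightarrow> finite G \<Longrightarrow> G \<subseteq> J - F \<Longrightarrow> (\<Sum>i\<in>G. \<bar>f i y\<bar>) \<le> 1"
    by (rule small_tailsE[OF tails zero_less_one, where x = x]) blast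
  have "continuous_on UNIV (\<lambda>y. \<Sum>i\<in>F. \<bar>f i y\<bar>)"
    by (intro continuous_intros cont)
  then have "((\<lambda>y. \<Sum>i\<in>F. \<bar>f i y\<bar>) \<longlongrightarrow> (\<Sum>i\<in>F. \<bar>f i x\<bar>)) (nhds x)"
    by (metis UNIV_I continuous_on_eq_continuous_at isCont_def open_UNIV tendsto_at_iff_tendsto_nhds)
  then have "\<forall>\<^sub>F y in nhds x. (\<Sum>i\<in>F. \<bar>f i y\<bar>) < (\<Sum>i\<in>F. \<bar>f i x\<bar>) + 1"
    by (rule order_tendstoD) simp
  then obtain d' where d': "d' > 0"
    and near: "\<And>y. dist y x < d' \<Longrightarrow> (\<Sum>i\<in>F. \<bar>f i y\<bar>) < (\<Sum>i\<in>F. \<bar>f i x\<bar>) + 1"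
    unfolding eventually_nhds_metric by blast
  show thesis
  proof (rule that[of "min d d'" "(\<Sum>i\<in>F. \<bar>f i x\<bar>) + 2"])
    show "min d d' > 0" using F d' by simp
    show "(\<Sum>i\<in>F. \<bar>f i x\<bar>) + 2 \<ge> 0" by (simp add: add_nonneg_nonneg sum_nonneg)
    fix y G assume y: "y \<in> ball x (min d d')" and G: "finite G" "G \<subseteq> J"
    have "(\<Sum>i\<in>G. \<bar>f i y\<bar>) = (\<Sum>i\<in>G \<inter> F. \<bar>f i y\<bar>) + (\<Sum>i\<in>G - F. \<bar>f i y\<bar>)"
      using G(1) by (rule sum.Int_Diff)
    also have "(\<Sum>i\<in>G \<inter> F. \<bar>f i y\<bar>) \<le> (\<Sum>i\<in>F. \<bar>f i y\<bar>)"
      using F by (intro sum_mono2) auto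
    also have "(\<Sum>i\<in>F. \<bar>f i y\<bar>) \<le> (\<Sum>i\<in>F. \<bar>f i x\<bar>) + 1"
      using near[of y] y by (simp add: dist_commute)
    also have "(\<Sum>i\<in>G - F. \<bar>f i y\<bar>) \<le> 1"
      using G y by (intro tail) auto
    finally show "(\<Sum>i\<in>G. \<bar>f i y\<bar>) \<le> (\<Sum>i\<in>F. \<bar>f i x\<bar>) + 2" by simp
  qed
qed

lemma small_tails_bounded_on_compact:
  assumes "compact K"
  obtains C where "C > 0"
    "\<And>y G. y \<in> K \<Longrightarrow> finite G \<Longrightarrow> G \<subseteq> J \<Longrightarrow> (\<Sum>i\<in>G. \<bar>f i y\<bar>) \<le> C"
proof -
  have "\<forall>x. \<exists>d C. d > 0 \<and> C \<ge> 0 \<and>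
      (\<forall>y\<in>ball x d. \<forall>G. finite G \<longrightarrow> G \<subseteq> J \<longrightarrow> (\<Sum>i\<in>G. \<bar>f i y\<bar>) \<le> C)"
    using small_tails_bounded_locally by metis
  then obtain d C where d: "\<And>x. d x > 0" and C: "\<And>x. C x \<ge> 0"
    and bd: "\<And>x y G. y \<in> ball x (d x) \<Longrightarrow> finite G \<Longrightarrow> G \<subseteq> J \<Longrightarrow> (\<Sum>i\<in>G. \<bar>f i y\<bar>) \<le> C x"
    by metis
  obtain X where X: "X \<subseteq> K" "finite X" "K \<subseteq> (\<Union>x\<in>X. ball x (d x))"
    using compactE_image[OF assms, of K "\<lambda>x. ball x (d x)"] d by force
  show thesis
  proof (rule that[of "sum C X + 1"])
    show "sum C X + 1 > 0" using C by (simp add: add_nonneg_pos sum_nonneg)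
    fix y G assume "y \<in> K" and G: "finite G" "G \<subseteq> J"
    with X obtain x where "x \<in> X" "y \<in> ball x (d x)" by blast
    then have "(\<Sum>i\<in>G. \<bar>f i y\<bar>) \<le> C x" using bd G by blast
    also have "C x \<le> sum C X" using X \<open>x \<in> X\<close> C by (simp add: member_le_sum)
    finally show "(\<Sum>i\<in>G. \<bar>f i y\<bar>) \<le> sum C X + 1" by simp
  qed
qed

lemma small_tails_abs_summable: "(\<lambda>i. \<bar>f i y\<bar>) summable_on J"
proof -
  obtain C where "C > 0"
    and "\<And>z G. z \<in> {y} \<Longrightarrow> finite G \<Longrightarrow> G \<subseteq> J \<Longrightarrow> (\<Sum>i\<in>G. \<bar>f i z\<bar>) \<le> C"
    by (rule small_tails_bounded_on_compact[of "{y}"]) simp_all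
  then show ?thesis
    by (intro nonneg_bdd_above_summable_on bdd_aboveI2) auto
qed

lemma small_tails_summable: "(\<lambda>i. f i y) summable_on J"
  using abs_summable_summable[of "\<lambda>i. f i y" J] small_tails_abs_summable by simp

lemma small_tails_infsum_continuous: "continuous_on UNIV (\<lambda>y. \<Sum>\<^sub>\<infinity>i\<in>J. f i y)"
  unfolding continuous_on_iff
proof (intro ballI allI impI)
  fix x e :: real assume "e > 0"
  then have e4: "e / 4 > 0" by simp
  obtain F d where F: "finite F" "F \<subseteq> J" "d > 0"
    and tail: "\<And>y G. y \<in> ball x d \<Longrightarrow> finite G \<Longrightarrow> G \<subseteq> J - F \<Longrightarrow> (\<Sum>i\<in>G. \<bar>f i y\<bar>) \<le> e / 4"
    by (rule small_tailsE[OF tails e4, where x = x]) blast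
  have approx: "\<bar>(\<Sum>\<^sub>\<infinity>i\<in>J. f i y) - (\<Sum>i\<in>F. f i y)\<bar> \<le> e / 4" if y: "y \<in> ball x d" for y
  proof -
    have sum': "(\<lambda>i. \<bar>f i y\<bar>) summable_on (J - F)"
      using small_tails_abs_summable by (rule summable_on_subset_banach) auto
    have "(\<Sum>\<^sub>\<infinity>i\<in>J. f i y) = (\<Sum>\<^sub>\<infinity>i\<in>F. f i y) + (\<Sum>\<^sub>\<infinity>i\<in>J - F. f i y)"
      using infsum_Un_disjoint[of "\<lambda>i. f i y" F "J - F"] F small_tails_summable[of y]
      by (metis Diff_disjoint Un_Diff_cancel sup.absorb_iff2 summable_on_finite
          summable_on_subset_banach Diff_subset)
    then have "\<bar>(\<Sum>\<^sub>\<infinity>i\<in>J. f i y) - (\<Sum>i\<in>F. f i y)\<bar> = \<bar>\<Sum>\<^sub>\<infinity>i\<in>J - F. f i y\<bar>"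
      using F by simp
    also have "\<dots> \<le> (\<Sum>\<^sub>\<infinity>i\<in>J - F. \<bar>f i y\<bar>)"
      using norm_infsum_bound[of "\<lambda>i. f i y" "J - F"] sum' by simp
    also have "\<dots> \<le> e / 4"
      using sum' tail[OF y] by (intro infsum_le_finite_sums) auto
    finally show ?thesis .
  qed
  have "continuous_on UNIV (\<lambda>y. \<Sum>i\<in>F. f i y)"
    by (intro continuous_intros cont)
  then obtain d' where d': "d' > 0"
    and near: "\<And>y. dist y x < d' \<Longrightarrow> dist (\<Sum>i\<in>F. f i y) (\<Sum>i\<in>F. f i x) < e / 4"
    using e4 unfolding continuous_on_iff by (metis UNIV_I)
  have "dist (\<Sum>\<^sub>\<infinity>i\<in>J. f i y) (\<Sum>\<^sub>\<infinity>i\<in>J. f i x) < e" if "dist y x < min d d'" for y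
  proof -
    have "y \<in> ball x d" "x \<in> ball x d" using that F(3) by (auto simp: dist_commute)
    then show ?thesis
      using approx[of y] approx[of x] near[of y] that e4 unfolding dist_real_def by linarith
  qed
  then show "\<exists>d>0. \<forall>y\<in>UNIV. dist y x < d \<longrightarrow>
      dist (\<Sum>\<^sub>\<infinity>i\<in>J. f i y) (\<Sum>\<^sub>\<infinity>i\<in>J. f i x) < e"
    using F d' by (intro exI[of _ "min d d'"]) auto
qed

end

section \<open>The homogeneous form\<close>

text \<open>Homogeneous coordinates put the values of \<open>P\<^sup>\<gamma>\<close> at poles and at infinity on the same footing as
  its other values: the limits in their definitions become evaluations of one continuous form.\<close>
definition homogeneous_form :: "nat \<Rightarrow> (real \<Rightarrow> real) \<Rightarrow> real \<Rightarrow> real \<Rightarrow> real \<Rightarrow> real" where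
  "homogeneous_form r P L u w = (if w = 0 then L * u ^ (2 * r) else w ^ (2 * r) * P (u / w))"

lemma homogeneous_form_scale:
  "homogeneous_form r P L (k * u) (k * w) = k ^ (2 * r) * homogeneous_form r P L u w"
  if "k \<noteq> 0"
  using that by (simp add: homogeneous_form_def power_mult_distrib)

lemma homogeneous_form_uminus:
  "homogeneous_form r P L (- (a * u) - b * w) (- (c * u) - d * w)
    = homogeneous_form r P L (a * u + b * w) (c * u + d * w)"
  using homogeneous_form_scale[of "-1" r P L "a * u + b * w" "c * u + d * w"] by simp

lift_definition form_slash :: "nat \<Rightarrow> (real \<Rightarrow> real) \<Rightarrow> real \<Rightarrow> pgl2z \<Rightarrow> real \<Rightarrow> real \<Rightarrow> real" is
  "\<lambda>r P L A u w. homogeneous_form r P L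
     (of_int (A$1$1) * u + of_int (A$1$2) * w) (of_int (A$2$1) * u + of_int (A$2$2) * w)"
  by (auto simp: pgl2_rel_def fun_eq_iff homogeneous_form_uminus)

lemma form_slash_scale:
  "k \<noteq> 0 \<Longrightarrow> form_slash r P L g (k * u) (k * w) = k ^ (2 * r) * form_slash r P L g u w"
proof (transfer, goal_cases)
  case (1 k r P L A u w)
  then show ?case
    using homogeneous_form_scale[of k r P L "of_int (A$1$1) * u + of_int (A$1$2) * w"
          "of_int (A$2$1) * u + of_int (A$2$2) * w"]
    by (simp add: algebra_simps)
qed

lemma form_slash_one: "form_slash r P L 1 u w = homogeneous_form r P L u w"
  by transfer (simp add: mat_def)

lemma form_slash_translation:
  "form_slash r P L (g * translation_elt) u w = form_slash r P L g (u + w) w"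
  by transfer (simp add: matrix_matrix_mult_def sum_2 algebra_simps)

lemma form_slash_negation:
  "form_slash r P L (g * negation_elt) u w = form_slash r P L g (- u) w"
  by transfer (simp add: matrix_matrix_mult_def sum_2 algebra_simps)

lemma form_slash_inversion:
  "form_slash r P L (g * inversion_elt) u w = form_slash r P L g w u"
  by transfer (simp add: matrix_matrix_mult_def sum_2 algebra_simps)

text \<open>The existential form hides the matrix entries: what matters is only that the same vector
  serves for every \<open>d\<close>, in particular for a stabiliser element and for \<open>1\<close>.\<close>
lemma form_slash_mult:
  obtains u' w' where "\<And>d. form_slash r P L (d * g) u w = form_slash r P L d u' w'"
proof -
  have "\<exists>u' w'. \<forall>d. form_slash r P L (d * g) u w = form_slash r P L d u' w'"
  proof (transfer, goal_cases)
    case (1 r P L A u w)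
    show ?case
      by (rule exI[of _ "of_int (A$1$1) * u + of_int (A$1$2) * w"],
          rule exI[of _ "of_int (A$2$1) * u + of_int (A$2$2) * w"])
        (simp add: matrix_matrix_mult_def sum_2 algebra_simps)
  qed
  then show thesis using that by blast
qed

lemma invertible_det_int:
  fixes A :: "int^2^2"
  assumes "invertible A"
  shows "A$1$1 * A$2$2 - A$1$2 * A$2$1 \<noteq> 0"
proof -
  from assms obtain B where "A ** B = mat 1" unfolding invertible_def by blast
  then have "det A * det B = 1" by (metis det_mul det_I)
  then have "det A \<noteq> 0" by auto
  then show ?thesis by (simp add: det_2)
qed

lemma linear_map_nonzero:
  fixes a b c d u w :: real
  assumes "a * d - b * c \<noteq> 0" "u \<noteq> 0 \<or> w \<noteq> 0"
  shows "a * u + b * w \<noteq> 0 \<or> c * u + d * w \<noteq> 0"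
proof (rule ccontr)
  assume "\<not> ?thesis"
  then have z: "a * u + b * w = 0" "c * u + d * w = 0" by auto
  have "(a * d - b * c) * u = d * (a * u + b * w) - b * (c * u + d * w)"
    "(a * d - b * c) * w = a * (c * u + d * w) - c * (a * u + b * w)"
    by (simp_all add: algebra_simps)
  with z assms show False by auto
qed

lemma moebius_nonzero:
  fixes A :: "int^2^2" and u w :: real
  assumes "invertible A" "u \<noteq> 0 \<or> w \<noteq> 0"
  shows "of_int (A$1$1) * u + of_int (A$1$2) * w \<noteq> 0
       \<or> of_int (A$2$1) * u + of_int (A$2$2) * w \<noteq> 0"
proof (rule linear_map_nonzero[OF _ assms(2)])
  show "real_of_int (A$1$1) * of_int (A$2$2) - of_int (A$1$2) * of_int (A$2$1) \<noteq> 0"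
    using invertible_det_int[OF assms(1)] by (metis of_int_diff of_int_eq_0_iff of_int_mult)
qed

lemma pgl2z_cases:
  obtains A :: "int^2^2" where "invertible A" "g = abs_pgl2z A"
  by (induction g rule: pgl2z.abs_induct) (auto simp: pgl2_rel_def)

lemma form_slash_matrix:
  "invertible A \<Longrightarrow> form_slash r P L (abs_pgl2z A) u w = homogeneous_form r P L
     (of_int (A$1$1) * u + of_int (A$1$2) * w) (of_int (A$2$1) * u + of_int (A$2$2) * w)"
  by (simp add: form_slash.abs_eq pgl2_rel_def)

lemma slash_matrix:
  "invertible A \<Longrightarrow> slash r P (abs_pgl2z A) x = (if moeb_den A x = 0
      then Lim (at x) (\<lambda>y. moeb_den A y ^ (2 * r) * P (moeb_num A y / moeb_den A y))
      else moeb_den A x ^ (2 * r) * P (moeb_num A x / moeb_den A x))"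
  by (simp add: slash.abs_eq pgl2_rel_def)

locale leading_coefficient =
  fixes r :: nat and P :: "real \<Rightarrow> real" and L :: real
  assumes P_cont: "continuous_on UNIV P"
    and rational_nonroot: "\<And>q. q \<in> \<rat> \<Longrightarrow> P q \<noteq> 0"
    and L_neg: "L < 0"
    and lim_bot: "((\<lambda>x. P x / x ^ (2 * r)) \<longlongrightarrow> L) at_bot"
    and lim_top: "((\<lambda>x. P x / x ^ (2 * r)) \<longlongrightarrow> L) at_top"
begin

abbreviation "form \<equiv> homogeneous_form r P L"
abbreviation "fs \<equiv> form_slash r P L"

lemma isCont_P: "isCont P x"
  using P_cont continuous_on_eq_continuous_at[OF open_UNIV] by blast

text \<open>Both ends of the line have the same leading coefficient, so the form extends continuously
  through \<open>w = 0\<close>; \<open>isCont_form_affine\<close> treats the chart \<open>u = 1\<close> around this point.\<close>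
lemma lim_infinity: "((\<lambda>x. P x / x ^ (2 * r)) \<longlongrightarrow> L) at_infinity"
  using lim_bot lim_top by (simp add: at_infinity_eq_at_top_bot filterlim_sup)

lemma isCont_form_affine: "isCont (\<lambda>t. form 1 t) t"
proof (cases "t = 0")
  case True
  have "((\<lambda>s. P (inverse s) / inverse s ^ (2 * r)) \<longlongrightarrow> L) (at 0)"
    by (rule filterlim_compose[OF lim_infinity filterlim_inverse_at_infinity])
  moreover have "\<forall>\<^sub>F s in at (0::real). P (inverse s) / inverse s ^ (2 * r) = form 1 s"
    unfolding homogeneous_form_def eventually_at
    by (intro exI[of _ 1]) (auto simp: field_simps)
  ultimately have "((\<lambda>s. form 1 s) \<longlongrightarrow> L) (at 0)"
    using tendsto_cong by force
  then show ?thesis using True by (simp add: isCont_def homogeneous_form_def)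
next
  case False
  have "isCont (\<lambda>s. s ^ (2 * r) * P (1 / s)) t"
    using False by (intro continuous_intros isCont_o2[OF _ isCont_P]) auto
  moreover have "\<forall>\<^sub>F s in nhds t. form 1 s = s ^ (2 * r) * P (1 / s)"
    using t1_space_nhds[OF False] by eventually_elim (simp add: homogeneous_form_def)
  ultimately show ?thesis by (simp add: isCont_cong)
qed

lemma isCont_form:
  assumes "isCont f x" "isCont g x" "f x \<noteq> 0 \<or> g x \<noteq> 0"
  shows "isCont (\<lambda>y::real. form (f y) (g y)) x"
proof (cases "g x = 0")
  case True
  with assms have fx: "f x \<noteq> 0" by simp
  have "isCont (\<lambda>y. f y ^ (2 * r) * form 1 (g y / f y)) x"
    using fx assms by (intro continuous_intros isCont_o2[OF _ isCont_form_affine]) auto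
  moreover have "\<forall>\<^sub>F y in nhds x. f y \<noteq> 0"
    using assms(1) fx
    by (metis isCont_def tendsto_at_iff_tendsto_nhds tendsto_imp_eventually_ne)
  then have "\<forall>\<^sub>F y in nhds x. form (f y) (g y) = f y ^ (2 * r) * form 1 (g y / f y)"
  proof eventually_elim
    case (elim y)
    then show ?case using homogeneous_form_scale[OF elim, of r P L 1 "g y / f y"] by simp
  qed
  ultimately show ?thesis by (simp add: isCont_cong)
next
  case False
  have "isCont (\<lambda>y. g y ^ (2 * r) * P (f y / g y)) x"
    using False assms by (intro continuous_intros isCont_o2[OF _ isCont_P]) auto
  moreover have "\<forall>\<^sub>F y in nhds x. g y \<noteq> 0"
    using assms(2) False
    by (metis isCont_def tendsto_at_iff_tendsto_nhds tendsto_imp_eventually_ne)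
  then have "\<forall>\<^sub>F y in nhds x. form (f y) (g y) = g y ^ (2 * r) * P (f y / g y)"
    by eventually_elim (simp add: homogeneous_form_def)
  ultimately show ?thesis by (simp add: isCont_cong)
qed

lemma isCont_fs:
  assumes "isCont f x" "isCont g x" "f x \<noteq> 0 \<or> g x \<noteq> 0"
  shows "isCont (\<lambda>y::real. fs \<gamma> (f y) (g y)) x"
proof -
  obtain A :: "int^2^2" where A: "invertible A" "\<gamma> = abs_pgl2z A"
    by (rule pgl2z_cases)
  show ?thesis
    unfolding A(2) form_slash_matrix[OF A(1)] using assms by (intro isCont_form moebius_nonzero[OF A(1)] continuous_intros)
qed

lemma slash_eq_form: "slash r P \<gamma> x = fs \<gamma> x 1"
proof -
  obtain A :: "int^2^2" where inv: "invertible A" and A: "\<gamma> = abs_pgl2z A"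
    by (rule pgl2z_cases)
  note eq = form_slash_matrix[OF inv, folded A] and slash = slash_matrix[OF inv, folded A]
  have nz: "moeb_num A x \<noteq> 0 \<or> moeb_den A x \<noteq> 0"
    using moebius_nonzero[OF inv, of x 1] by (simp add: moeb_num_def moeb_den_def)
  show ?thesis
  proof (cases "moeb_den A x = 0")
    case True
    have c: "A$2$1 \<noteq> 0"
      using True invertible_det_int[OF inv] by (auto simp: moeb_den_def)
    have "isCont (\<lambda>y. form (moeb_num A y) (moeb_den A y)) x"
      unfolding moeb_num_def moeb_den_def
      using nz[unfolded moeb_num_def moeb_den_def]
      by (intro isCont_form continuous_intros) auto
    then have "((\<lambda>y. form (moeb_num A y) (moeb_den A y)) \<longlongrightarrow> form (moeb_num A x) (moeb_den A x)) (at x)"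
      by (simp add: isCont_def)
    moreover have "\<forall>\<^sub>F y in at x. form (moeb_num A y) (moeb_den A y)
        = moeb_den A y ^ (2 * r) * P (moeb_num A y / moeb_den A y)"
    proof -
      have "moeb_den A y \<noteq> 0" if "y \<noteq> x" for y
      proof
        assume "moeb_den A y = 0"
        with True have "of_int (A$2$1) * (y - x) = 0"
          unfolding moeb_den_def right_diff_distrib by linarith
        with c that show False by simp
      qed
      then show ?thesis
        unfolding eventually_at
        by (intro exI[of _ 1]) (auto simp: homogeneous_form_def)
    qed
    ultimately have "((\<lambda>y. moeb_den A y ^ (2 * r) * P (moeb_num A y / moeb_den A y))
        \<longlongrightarrow> form (moeb_num A x) (moeb_den A x)) (at x)"
      using tendsto_cong by fast
    then have "Lim (at x) (\<lambda>y. moeb_den A y ^ (2 * r) * P (moeb_num A y / moeb_den A y))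
        = form (moeb_num A x) (moeb_den A x)"
      by (intro tendsto_Lim) auto
    with True show ?thesis by (simp add: slash eq moeb_num_def moeb_den_def)
  next
    case False
    then show ?thesis by (simp add: slash eq homogeneous_form_def moeb_num_def moeb_den_def)
  qed
qed

lemma fs_lim_infinity: "((\<lambda>x. fs \<gamma> x 1 / x ^ (2 * r)) \<longlongrightarrow> fs \<gamma> 1 0) at_infinity"
proof -
  have "isCont (\<lambda>t. fs \<gamma> 1 t) 0"
    by (rule isCont_fs) auto
  then have "((\<lambda>x. fs \<gamma> 1 (inverse x)) \<longlongrightarrow> fs \<gamma> 1 0) at_infinity"
    by (rule isCont_tendsto_compose) (rule tendsto_inverse_0)
  moreover have "\<forall>\<^sub>F x::real in at_infinity. fs \<gamma> 1 (inverse x) = fs \<gamma> x 1 / x ^ (2 * r)"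
    using eventually_not_equal_at_infinity[of 0]
  proof eventually_elim
    case (elim x)
    then show ?case using form_slash_scale[of x r P L \<gamma> 1 "inverse x"] by simp
  qed
  ultimately show ?thesis using tendsto_cong by fast
qed

lemma slash_infty_eq_form: "slash_infty r P \<gamma> = fs \<gamma> 1 0"
  unfolding slash_infty_def slash_eq_form
  by (intro tendsto_Lim fs_lim_infinity trivial_limit_at_infinity)

text \<open>An invertible integer matrix maps a nonzero integer vector to a nonzero integer vector
  \<open>(p, q)\<close>; there the form is a nonzero multiple of \<open>P(p/q)\<close>, or of \<open>L\<close> if \<open>q = 0\<close>.\<close>
lemma fs_nonzero_int:
  fixes a c :: int
  assumes "a \<noteq> 0 \<or> c \<noteq> 0"
  shows "fs \<gamma> (of_int a) (of_int c) \<noteq> 0"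
proof -
  obtain A :: "int^2^2" where inv: "invertible A" and A: "\<gamma> = abs_pgl2z A"
    by (rule pgl2z_cases)
  note eq = form_slash_matrix[OF inv, folded A]
  define p q where "p = A$1$1 * a + A$1$2 * c" and "q = A$2$1 * a + A$2$2 * c"
  have "real_of_int p \<noteq> 0 \<or> real_of_int q \<noteq> 0"
    using moebius_nonzero[OF inv, of "of_int a" "of_int c"] assms by (simp add: p_def q_def)
  then have "form (of_int p) (of_int q) \<noteq> 0"
    using L_neg rational_nonroot[of "of_int p / of_int q"]
    by (auto simp: homogeneous_form_def)
  then show ?thesis by (simp add: eq p_def q_def)
qed

lemma fs_nonzero [simp]: "fs \<gamma> 1 0 \<noteq> 0" "fs \<gamma> 0 1 \<noteq> 0"
  using fs_nonzero_int[of 1 0] fs_nonzero_int[of 0 1] by simp_all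

lemma signed_slash_eq: "signed_slash r P \<gamma> x = - sgn (fs \<gamma> 1 0) * fs \<gamma> x 1"
  using fs_nonzero(1)[of \<gamma>]
  by (auto simp: signed_slash_def slash_sign_def slash_infty_eq_form slash_eq_form sgn_if)

lemma abs_signed_slash: "\<bar>signed_slash r P \<gamma> x\<bar> = \<bar>slash r P \<gamma> x\<bar>"
  by (simp add: signed_slash_def slash_sign_def)

lemma one_in_stabiliser: "1 \<in> stabiliser r P"
proof -
  have "signed_slash r P 1 x = P x" for x
    using L_neg by (simp add: signed_slash_eq form_slash_one homogeneous_form_def)
  then show ?thesis by (auto simp: stabiliser_def)
qed

text \<open>The stabiliser condition speaks only of the affine points \<open>(x, 1)\<close>. It extends to all vectors
  by homogeneity, and to \<open>w = 0\<close> by comparing the growth at infinity.\<close>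
lemma fs_stabiliser:
  assumes "d \<in> stabiliser r P"
  shows "\<bar>fs d u w\<bar> = \<bar>form u w\<bar>"
proof (cases "w = 0")
  case False
  have "\<bar>fs d (u / w) 1\<bar> = \<bar>P (u / w)\<bar>"
    using assms abs_signed_slash[of d "u / w"] by (simp add: stabiliser_def slash_eq_form)
  then show ?thesis
    using form_slash_scale[OF False, of r P L d "u / w" 1] False
    by (simp add: homogeneous_form_def abs_mult)
next
  case True
  have 1: "\<bar>fs d 1 0\<bar> = \<bar>L\<bar>"
  proof (rule tendsto_unique)
    show "((\<lambda>x. \<bar>fs d x 1 / x ^ (2 * r)\<bar>) \<longlongrightarrow> \<bar>fs d 1 0\<bar>) at_infinity"
      by (intro tendsto_rabs fs_lim_infinity)
    have "\<bar>fs d x 1 / x ^ (2 * r)\<bar> = \<bar>P x / x ^ (2 * r)\<bar>" for x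
      using assms abs_signed_slash[of d x] by (simp add: stabiliser_def slash_eq_form)
    then show "((\<lambda>x. \<bar>fs d x 1 / x ^ (2 * r)\<bar>) \<longlongrightarrow> \<bar>L\<bar>) at_infinity"
      using tendsto_rabs[OF lim_infinity] by (simp only:)
  qed (rule trivial_limit_at_infinity)
  have 0: "fs d 0 0 = form 0 0"
    by (rule pgl2z_cases[of d]) (simp add: form_slash_matrix)
  show ?thesis
  proof (cases "u = 0")
    case True
    then show ?thesis using 0 \<open>w = 0\<close> by simp
  next
    case False
    then show ?thesis
      using form_slash_scale[OF False, of r P L d 1 0] 1 True
      by (simp add: homogeneous_form_def abs_mult)
  qed
qed

text \<open>Hence the series of Property (2), written with the fixed function \<open>P\<^sup>\<gamma>\<close>, is the sum of
  \<open>\<lambda>(\<delta>, x) |P\<^sup>\<delta>(x)|\<close> over \<open>\<delta>\<close> in the coset of \<open>\<gamma>\<close>.\<close>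
lemma slash_stabiliser_coset:
  assumes "d \<in> stabiliser r P"
  shows "\<bar>slash r P (d * g) x\<bar> = \<bar>slash r P g x\<bar>"
proof -
  obtain u w where uw: "\<And>d. fs (d * g) x 1 = fs d u w"
    using form_slash_mult by blast
  have "\<bar>fs d u w\<bar> = \<bar>fs 1 u w\<bar>"
    using assms one_in_stabiliser by (simp add: fs_stabiliser)
  then show ?thesis
    using uw[of d] uw[of 1] by (simp add: slash_eq_form)
qed

end

section \<open>Moving the cusp of the weighted sum\<close>

lemma bij_right_mult: "bij (\<lambda>g::pgl2z. g * s)"
  by (rule o_bij[of "\<lambda>g. g * inverse s"])
    (simp_all add: fun_eq_iff mult.assoc pgl2z_right_inverse pgl2z_left_inverse)

locale weighted_sum_data = leading_coefficient +
  fixes lam :: "pgl2z \<Rightarrow> real \<Rightarrow> real"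
  assumes r: "r \<ge> 1"
    and lam_nonneg: "\<And>g x. lam g x \<ge> 0"
    and compat: "\<And>s g x. s \<in> {translation_elt, negation_elt, inversion_elt} \<Longrightarrow>
        \<not> maps_to_infinity s x \<Longrightarrow> lam (g * inverse s) (moebius_map s x) = lam g x"
    and prop1: "\<And>g. continuous_on UNIV (\<lambda>x. lam g x * signed_slash r P g x)"
    and prop2: "\<And>g. locally_uniformly_summable
        (\<lambda>d x. lam (d * g) x * \<bar>slash r P g x\<bar>) (stabiliser r P)"
    and prop3: "finite (stabiliser_coset r P ` {g. signed_slash r P g 0 > 0})"
begin

lemma lam_generator:
  assumes "s \<in> {translation_elt, negation_elt, inversion_elt}" "\<not> maps_to_infinity s x"
  shows "lam g (moebius_map s x) = lam (g * s) x"
  using compat[OF assms, of "g * s"] by (simp add: mult.assoc pgl2z_right_inverse)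

lemma lam_translation: "lam g (x + 1) = lam (g * translation_elt) x"
  and lam_negation: "lam g (- x) = lam (g * negation_elt) x"
  and lam_inversion: "x \<noteq> 0 \<Longrightarrow> lam g (1 / x) = lam (g * inversion_elt) x"
  using lam_generator[of translation_elt x g] lam_generator[of negation_elt x g]
    lam_generator[of inversion_elt x g]
  by (simp_all add: moebius_generators)

text \<open>For the cusp \<open>(a, c) = (1, 0)\<close> this is the term of the weighted sum. A general cusp is allowed
  because the cusp moves under inversion; the term depends on it only through the sign of the
  form there.\<close>
definition term_at :: "pgl2z \<Rightarrow> real \<Rightarrow> real \<Rightarrow> real \<Rightarrow> real" where
  "term_at g a c x = lam g x * max (- sgn (fs g a c) * fs g x 1) 0"

lemma term_at_nonneg: "term_at g a c x \<ge> 0"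
  by (simp add: term_at_def lam_nonneg)

lemma term_at_infinity: "lam g x * pos_part (signed_slash r P g) x = term_at g 1 0 x"
  by (simp add: term_at_def pos_part_def signed_slash_eq)

lemma term_at_translation: "term_at g (a + c) c (x + 1) = term_at (g * translation_elt) a c x"
  by (simp add: term_at_def lam_translation form_slash_translation)

lemma term_at_negation: "term_at g (- a) c (- x) = term_at (g * negation_elt) a c x"
  by (simp add: term_at_def lam_negation form_slash_negation)

lemma term_at_inversion:
  assumes "x \<noteq> 0"
  shows "x ^ (2 * r) * term_at g c a (1 / x) = term_at (g * inversion_elt) a c x"
proof -
  have pos: "x ^ (2 * r) > 0" using assms by (simp add: power_mult)
  have "fs g 1 x = x ^ (2 * r) * fs g (1 / x) 1"
    using form_slash_scale[OF assms, of r P L g "1 / x" 1] assms by simp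
  then have "max (- sgn (fs g c a) * fs g 1 x) 0
      = x ^ (2 * r) * max (- sgn (fs g c a) * fs g (1 / x) 1) 0"
    using pos by (simp add: max_mult_distrib_left mult.left_commute)
  then show ?thesis
    by (simp add: term_at_def lam_inversion[OF assms] form_slash_inversion)
qed

text \<open>The indices of the remainder are those for which the form separates the cusps \<open>(1, 0)\<close> and
  \<open>(0, 1)\<close>.\<close>
lemma positive_at_zero_iff: "g \<in> positive_at_zero r P \<longleftrightarrow> sgn (fs g 1 0) \<noteq> sgn (fs g 0 1)"
proof -
  have "g \<in> positive_at_zero r P \<longleftrightarrow> - sgn (fs g 1 0) * fs g 0 1 > 0"
    by (auto simp: positive_at_zero_def pos_part_def signed_slash_eq)
  also have "\<dots> \<longleftrightarrow> sgn (fs g 1 0) \<noteq> sgn (fs g 0 1)"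
    by (cases "fs g 1 0" "0::real" rule: linorder_cases;
        cases "fs g 0 1" "0::real" rule: linorder_cases; simp)
  finally show ?thesis .
qed

text \<open>With \<open>q\<close> the signed slash, the identity \<open>max q 0 - max (- q) 0 = q\<close> accounts for the terms
  whose sign condition is reversed by the change of cusp; all others are unchanged.\<close>
lemma term_at_zero:
  "term_at g 1 0 x = term_at g 0 1 x +
    (if g \<in> positive_at_zero r P then lam g x * signed_slash r P g x else 0)"
proof (cases "g \<in> positive_at_zero r P")
  case False
  then show ?thesis by (simp add: positive_at_zero_iff term_at_def)
next
  case True
  then have "sgn (fs g 0 1) = - sgn (fs g 1 0)"
    by (cases "fs g 1 0" "0::real" rule: linorder_cases;
        cases "fs g 0 1" "0::real" rule: linorder_cases; simp add: positive_at_zero_iff)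
  then have "max (- sgn (fs g 1 0) * fs g x 1) 0
      = max (- sgn (fs g 0 1) * fs g x 1) 0 + signed_slash r P g x"
    by (simp add: signed_slash_eq max_def)
  then show ?thesis using True by (simp add: term_at_def distrib_left)
qed

text \<open>The index set of the remainder is covered by finitely many cosets of the stabiliser by
  Property (3), and over each of them the sum converges locally uniformly by Property (2).\<close>
lemma positive_at_zero_small_tails:
  "small_tails (\<lambda>g x. \<bar>lam g x * signed_slash r P g x\<bar>) (positive_at_zero r P)"
proof -
  let ?h = "\<lambda>g x. \<bar>lam g x * signed_slash r P g x\<bar>"
  let ?C = "stabiliser_coset r P ` {g. signed_slash r P g 0 > 0}"
  have "small_tails ?h (stabiliser_coset r P g)" for g
    unfolding stabiliser_coset_def
  proof (rule small_tails_image)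
    show "inj_on (\<lambda>d. d * g) (stabiliser r P)"
      using bij_is_inj[OF bij_right_mult] by (rule inj_on_subset) simp
    have eq: "?h (d * g) x = lam (d * g) x * \<bar>slash r P g x\<bar>"
      if "d \<in> stabiliser r P" for d x
      using slash_stabiliser_coset[OF that] lam_nonneg
      by (simp add: abs_mult abs_signed_slash)
    show "small_tails (\<lambda>d. ?h (d * g)) (stabiliser r P)"
      by (rule small_tails_mono[OF locally_uniformly_summable_imp_small_tails[OF prop2[of g]]])
        (auto simp: eq)
  qed
  then have "small_tails ?h (\<Union>?C)"
    by (intro small_tails_Union prop3) auto
  moreover have "positive_at_zero r P \<subseteq> \<Union>?C"
  proof
    fix g assume "g \<in> positive_at_zero r P"
    then have "signed_slash r P g 0 > 0"
      by (auto simp: positive_at_zero_def pos_part_def)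
    moreover have "g \<in> stabiliser_coset r P g"
      unfolding stabiliser_coset_def using one_in_stabiliser by force
    ultimately show "g \<in> \<Union>?C" by blast
  qed
  ultimately show ?thesis by (rule small_tails_mono) simp
qed

lemmas remainder_summable = small_tails_summable[OF prop1 positive_at_zero_small_tails]

lemma remainder_continuous: "continuous_on UNIV (remainder_sum r P lam)"
  using small_tails_infsum_continuous[OF prop1 positive_at_zero_small_tails]
  by (simp add: remainder_sum_def[abs_def])

section \<open>Convergence by continued fractions\<close>

lemma integer_translate_induct:
  fixes x :: real
  assumes step: "\<And>x. Q (x + 1) \<longleftrightarrow> Q x"
    and small: "\<And>x. \<bar>x\<bar> \<le> 1 / 2 \<Longrightarrow> Q x"
  shows "Q x"
proof -
  have nat: "Q (y + real n) \<longleftrightarrow> Q y" for y n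
  proof (induction n)
    case (Suc n)
    then show ?case using step[of "y + real n"] by (simp add: add_ac)
  qed simp
  have "Q (y + of_int k) \<longleftrightarrow> Q y" for y k
    using nat[of y "nat k"] nat[of "y + of_int k" "nat (- k)"] by (cases "k \<ge> 0") auto
  from this[of "x - of_int (round x)" "round x"] small[of "x - of_int (round x)"]
  show ?thesis
    using of_int_round_abs_le[of x] by (simp add: abs_minus_commute)
qed
lemma half_power_bound: "\<bar>x\<bar> \<le> 1 / 2 \<Longrightarrow> x ^ (2 * r) \<le> 1 / 4" for x :: real
proof -
  assume x: "\<bar>x\<bar> \<le> 1 / 2"
  have "x ^ (2 * r) = \<bar>x\<bar> ^ (2 * r)" by (simp add: power_even_abs)
  also have "\<dots> \<le> \<bar>x\<bar> ^ 2" using x r by (intro power_decreasing) auto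
  also have "\<dots> \<le> (1 / 2) ^ 2" using x by (intro power_mono) auto
  finally show ?thesis by (simp add: power2_eq_square)
qed

text \<open>The induction prepends a step of the continued fraction: translate \<open>x\<close> into \<open>[-1/2, 1/2]\<close>,
  change the cusp from \<open>(1, 0)\<close> to \<open>(0, 1)\<close> at cost \<open>C\<close>, and invert, which turns that cusp back into
  \<open>(1, 0)\<close>. The bound \<open>2 C\<close> reproduces itself since \<open>C + 2 C / 4 \<le> 2 C\<close>. The vector \<open>(a, c)\<close> is
  independent of \<open>F\<close> because each step replaces \<open>F\<close> by a translate \<open>F \<sigma>\<close> of itself in the group.\<close>
lemma finite_sum_descent:
  assumes C: "C > 0"
    and bd: "\<And>y G. \<bar>y\<bar> \<le> 1 / 2 \<Longrightarrow> finite G \<Longrightarrow> G \<subseteq> positive_at_zero r P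
      \<Longrightarrow> (\<Sum>g\<in>G. \<bar>lam g y * signed_slash r P g y\<bar>) \<le> C"
  shows "\<exists>a c :: int. (a \<noteq> 0 \<or> c \<noteq> 0) \<and> \<bar>of_int a - of_int c * x\<bar> \<le> (1 / 2) ^ k \<and>
    (\<forall>F. finite F \<longrightarrow> (\<Sum>g\<in>F. term_at g 1 0 x) \<le> 2 * C + (\<Sum>g\<in>F. term_at g (of_int a) (of_int c) x))"
    (is "?B k x")
proof (induction k arbitrary: x)
  case 0
  show ?case using C by (intro exI[of _ 1] exI[of _ 0]) auto
next
  case (Suc k)
  have inj: "inj_on (\<lambda>g. g * s) F" for s :: pgl2z and F
    using bij_is_inj[OF bij_right_mult] by (rule inj_on_subset) simp
  have reindex: "sum f ((\<lambda>g. g * s) ` F) = (\<Sum>g\<in>F. f (g * s))" for s F and f :: "pgl2z \<Rightarrow> real"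
    by (simp add: sum.reindex[OF inj])
  have change_cusp: "(\<Sum>g\<in>F. term_at g 1 0 y) \<le> C + (\<Sum>g\<in>F. term_at g 0 1 y)"
    if "\<bar>y\<bar> \<le> 1 / 2" "finite F" for y F
  proof -
    have "(\<Sum>g\<in>F. term_at g 1 0 y) = (\<Sum>g\<in>F. term_at g 0 1 y) +
        (\<Sum>g\<in>F. if g \<in> positive_at_zero r P then lam g y * signed_slash r P g y else 0)"
      by (simp add: term_at_zero sum.distrib)
    also have "(\<Sum>g\<in>F. if g \<in> positive_at_zero r P then lam g y * signed_slash r P g y else 0)
        = (\<Sum>g\<in>F \<inter> positive_at_zero r P. lam g y * signed_slash r P g y)"
      using that by (simp add: sum.inter_restrict)
    also have "\<dots> \<le> (\<Sum>g\<in>F \<inter> positive_at_zero r P. \<bar>lam g y * signed_slash r P g y\<bar>)"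
      by (intro sum_mono) auto
    also have "\<dots> \<le> C" using that by (intro bd) auto
    finally show ?thesis by simp
  qed
  show ?case
  proof (rule integer_translate_induct[where Q = "?B (Suc k)"])
    fix x :: real
    show "?B (Suc k) (x + 1) \<longleftrightarrow> ?B (Suc k) x"
    proof
      assume "?B (Suc k) (x + 1)"
      then obtain a c :: int where ac: "a \<noteq> 0 \<or> c \<noteq> 0"
        and ap: "\<bar>of_int a - of_int c * (x + 1)\<bar> \<le> (1 / 2) ^ Suc k"
        and le: "\<And>F. finite F \<Longrightarrow> (\<Sum>g\<in>F. term_at g 1 0 (x + 1))
            \<le> 2 * C + (\<Sum>g\<in>F. term_at g (of_int a) (of_int c) (x + 1))" by blast
      show "?B (Suc k) x"
      proof (rule exI[of _ "a - c"], rule exI[of _ c], intro conjI allI impI)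
        show "a - c \<noteq> 0 \<or> c \<noteq> 0" using ac by auto
        show "\<bar>of_int (a - c) - of_int c * x\<bar> \<le> (1 / 2) ^ Suc k"
          using ap by (simp add: algebra_simps)
        fix F :: "pgl2z set" assume F: "finite F"
        let ?G = "(\<lambda>g. g * inverse translation_elt) ` F"
        have "(\<Sum>g\<in>?G. term_at g 1 0 (x + 1)) = (\<Sum>g\<in>F. term_at g 1 0 x)"
          using term_at_translation[of _ 1 0 x]
          by (simp add: reindex mult.assoc pgl2z_left_inverse)
        moreover have "(\<Sum>g\<in>?G. term_at g (of_int a) (of_int c) (x + 1))
            = (\<Sum>g\<in>F. term_at g (of_int (a - c)) (of_int c) x)"
          using term_at_translation[of _ "of_int (a - c)" "of_int c" x]
          by (simp add: reindex mult.assoc pgl2z_left_inverse)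
        ultimately show "(\<Sum>g\<in>F. term_at g 1 0 x)
            \<le> 2 * C + (\<Sum>g\<in>F. term_at g (of_int (a - c)) (of_int c) x)"
          using le[of ?G] F by simp
      qed
    next
      assume "?B (Suc k) x"
      then obtain a c :: int where ac: "a \<noteq> 0 \<or> c \<noteq> 0"
        and ap: "\<bar>of_int a - of_int c * x\<bar> \<le> (1 / 2) ^ Suc k"
        and le: "\<And>F. finite F \<Longrightarrow> (\<Sum>g\<in>F. term_at g 1 0 x)
            \<le> 2 * C + (\<Sum>g\<in>F. term_at g (of_int a) (of_int c) x)" by blast
      show "?B (Suc k) (x + 1)"
      proof (rule exI[of _ "a + c"], rule exI[of _ c], intro conjI allI impI)
        show "a + c \<noteq> 0 \<or> c \<noteq> 0" using ac by auto
        show "\<bar>of_int (a + c) - of_int c * (x + 1)\<bar> \<le> (1 / 2) ^ Suc k"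
          using ap by (simp add: algebra_simps)
        fix F :: "pgl2z set" assume F: "finite F"
        show "(\<Sum>g\<in>F. term_at g 1 0 (x + 1))
            \<le> 2 * C + (\<Sum>g\<in>F. term_at g (of_int (a + c)) (of_int c) (x + 1))"
          using le[of "(\<lambda>g. g * translation_elt) ` F"] F
            term_at_translation[of _ 1 0 x] term_at_translation[of _ "of_int a" "of_int c" x]
          by (simp add: reindex)
      qed
    qed
  next
    fix x :: real assume x: "\<bar>x\<bar> \<le> 1 / 2"
    show "?B (Suc k) x"
    proof (cases "x = 0")
      case True
      \<comment> \<open>The continued fraction has terminated, and the cusp \<open>(0, 1)\<close> represents \<open>x\<close> exactly.\<close>
      show ?thesis
      proof (rule exI[of _ 0], rule exI[of _ 1], intro conjI allI impI)
        fix F :: "pgl2z set" assume "finite F"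
        from change_cusp[OF x this] C
        show "(\<Sum>g\<in>F. term_at g 1 0 x) \<le> 2 * C + (\<Sum>g\<in>F. term_at g (of_int 0) (of_int 1) x)"
          by simp
      qed (simp_all add: True)
    next
      case False
      from Suc.IH[of "1 / x"] obtain a c :: int where ac: "a \<noteq> 0 \<or> c \<noteq> 0"
        and ap: "\<bar>of_int a - of_int c * (1 / x)\<bar> \<le> (1 / 2) ^ k"
        and le: "\<And>F. finite F \<Longrightarrow> (\<Sum>g\<in>F. term_at g 1 0 (1 / x))
            \<le> 2 * C + (\<Sum>g\<in>F. term_at g (of_int a) (of_int c) (1 / x))" by blast
      have inv: "(\<Sum>g\<in>(\<lambda>g. g * inverse inversion_elt) ` F. x ^ (2 * r) * term_at g p q (1 / x))
          = (\<Sum>g\<in>F. term_at g q p x)" for F p q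
        by (simp add: reindex term_at_inversion[OF False] mult.assoc pgl2z_left_inverse)
      show ?thesis
      proof (rule exI[of _ c], rule exI[of _ a], intro conjI allI impI)
        show "c \<noteq> 0 \<or> a \<noteq> 0" using ac by auto
        have "\<bar>of_int c - of_int a * x\<bar> = \<bar>x\<bar> * \<bar>of_int a - of_int c * (1 / x)\<bar>"
          using False by (simp add: abs_mult[symmetric] abs_minus_commute field_simps)
        also have "\<dots> \<le> (1 / 2) * (1 / 2) ^ k" using x ap by (intro mult_mono) auto
        finally show "\<bar>of_int c - of_int a * x\<bar> \<le> (1 / 2) ^ Suc k" by simp
        fix F :: "pgl2z set" assume F: "finite F"
        let ?G = "(\<lambda>g. g * inverse inversion_elt) ` F"
        have "(\<Sum>g\<in>F. term_at g 1 0 x) \<le> C + (\<Sum>g\<in>F. term_at g 0 1 x)"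
          using change_cusp[OF x F] .
        also have "(\<Sum>g\<in>F. term_at g 0 1 x) = x ^ (2 * r) * (\<Sum>g\<in>?G. term_at g 1 0 (1 / x))"
          by (simp only: inv[symmetric] sum_distrib_left)
        also have "\<dots> \<le> x ^ (2 * r) * (2 * C + (\<Sum>g\<in>?G. term_at g (of_int a) (of_int c) (1 / x)))"
          using F by (intro mult_left_mono le) (auto simp: power_mult)
        also have "\<dots> = x ^ (2 * r) * (2 * C) + (\<Sum>g\<in>F. term_at g (of_int c) (of_int a) x)"
          by (simp only: inv[symmetric] sum_distrib_left distrib_left)
        also have "x ^ (2 * r) * (2 * C) \<le> 1 / 4 * (2 * C)"
          using half_power_bound[OF x] C by (intro mult_right_mono) auto
        finally show "(\<Sum>g\<in>F. term_at g 1 0 x)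
            \<le> 2 * C + (\<Sum>g\<in>F. term_at g (of_int c) (of_int a) x)"
          using C by simp
      qed
    qed
  qed
qed

text \<open>Every sign condition that contributes is open, so it fails at a cusp close enough to \<open>x\<close>; then
  the sum on the right of the descent is zero.\<close>
lemma finite_sums_bounded:
  obtains C where "C > 0" "\<And>F x. finite F \<Longrightarrow> (\<Sum>g\<in>F. term_at g 1 0 x) \<le> C"
proof -
  obtain C where C: "C > 0"
    and bd: "\<And>y G. y \<in> {-1/2..1/2} \<Longrightarrow> finite G \<Longrightarrow> G \<subseteq> positive_at_zero r P
      \<Longrightarrow> (\<Sum>g\<in>G. \<bar>lam g y * signed_slash r P g y\<bar>) \<le> C"
    by (rule small_tails_bounded_on_compact[OF prop1 positive_at_zero_small_tails
          compact_Icc[of "-1/2" "1/2"]]) blast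
  have bd': "(\<Sum>g\<in>G. \<bar>lam g y * signed_slash r P g y\<bar>) \<le> C"
    if "\<bar>y\<bar> \<le> 1 / 2" "finite G" "G \<subseteq> positive_at_zero r P" for y G
    using that by (intro bd) auto
  show thesis
  proof (rule that[of "2 * C"])
    show "2 * C > 0" using C by simp
    fix F :: "pgl2z set" and x assume F: "finite F"
    have "\<forall>\<^sub>F y in nhds x. term_at g y 1 x = 0" for g
    proof (cases "fs g x 1 = 0")
      case False
      have "isCont (\<lambda>y. fs g y 1) x" by (rule isCont_fs) auto
      then have "((\<lambda>y. fs g y 1) \<longlongrightarrow> fs g x 1) (nhds x)"
        using tendsto_at_iff_tendsto_nhds[of "\<lambda>y. fs g y 1" x] by (simp add: isCont_def)
      then have "((\<lambda>y. fs g y 1 * fs g x 1) \<longlongrightarrow> fs g x 1 * fs g x 1) (nhds x)"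
        by (intro tendsto_intros)
      moreover have "fs g x 1 * fs g x 1 > 0" using False by (auto simp: zero_less_mult_iff linorder_neq_iff)
      ultimately have "\<forall>\<^sub>F y in nhds x. fs g y 1 * fs g x 1 > 0"
        by (rule order_tendstoD)
      then show ?thesis
        by eventually_elim (auto simp: term_at_def sgn_if zero_less_mult_iff)
    qed (simp add: term_at_def)
    then have "\<forall>\<^sub>F y in nhds x. \<forall>g\<in>F. term_at g y 1 x = 0"
      using F by (simp add: eventually_ball_finite)
    then obtain e where e: "e > 0"
      and near: "\<And>y g. dist y x < e \<Longrightarrow> g \<in> F \<Longrightarrow> term_at g y 1 x = 0"
      unfolding eventually_nhds_metric by blast
    \<comment> \<open>Beyond the closeness \<open>e\<close>, an error below \<open>1\<close> is required to exclude \<open>c = 0\<close>.\<close>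
    obtain k where k: "(1 / 2) ^ k < min e 1"
      using real_arch_pow_inv[of "min e 1" "1 / 2"] e by auto
    from finite_sum_descent[OF C bd', of x k] obtain a c :: int where ac: "a \<noteq> 0 \<or> c \<noteq> 0"
      and ap: "\<bar>of_int a - of_int c * x\<bar> \<le> (1 / 2) ^ k"
      and le: "(\<Sum>g\<in>F. term_at g 1 0 x) \<le> 2 * C + (\<Sum>g\<in>F. term_at g (of_int a) (of_int c) x)"
      using F by auto
    have c: "c \<noteq> 0" using ac ap k by auto
    have "term_at g (of_int a) (of_int c) x = 0" if "g \<in> F" for g
    proof -
      have "\<bar>of_int a / of_int c - x\<bar> = \<bar>of_int a - of_int c * x\<bar> / \<bar>of_int c\<bar>"
        using c by (simp add: field_simps flip: abs_divide)
      also have "\<dots> \<le> \<bar>of_int a - of_int c * x\<bar> / 1"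
        using c by (intro divide_left_mono) auto
      also have "\<dots> < e" using ap k by simp
      finally have "term_at g (of_int a / of_int c) 1 x = 0"
        using that by (intro near) (auto simp: dist_real_def)
      moreover have "sgn (fs g (of_int a) (of_int c)) = sgn (fs g (of_int a / of_int c) 1)"
      proof -
        have "real_of_int c ^ (2 * r) > 0" using c by (simp add: power_mult)
        moreover have "fs g (of_int a) (of_int c)
            = of_int c ^ (2 * r) * fs g (of_int a / of_int c) 1"
          using form_slash_scale[of "of_int c" r P L g "of_int a / of_int c" 1] c by simp
        ultimately show ?thesis by (simp only: sgn_mult sgn_pos mult_1)
      qed
      ultimately show ?thesis by (simp add: term_at_def)
    qed
    with le show "(\<Sum>g\<in>F. term_at g 1 0 x) \<le> 2 * C" by simp
  qed
qed

abbreviation "T \<equiv> weighted_sum r P lam"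
abbreviation "R \<equiv> remainder_sum r P lam"

lemma T_eq: "T x = (\<Sum>\<^sub>\<infinity>g. term_at g 1 0 x)"
  by (simp add: weighted_sum_def term_at_infinity)

lemma T_summable: "(\<lambda>g. term_at g 1 0 x) summable_on UNIV"
proof -
  obtain C where "\<And>F. finite F \<Longrightarrow> (\<Sum>g\<in>F. term_at g 1 0 x) \<le> C"
    using finite_sums_bounded by metis
  then show ?thesis
    by (intro nonneg_bdd_above_summable_on bdd_aboveI2) (auto simp: term_at_nonneg)
qed

lemma T_bounded: obtains C where "C > 0" "\<And>x. \<bar>T x\<bar> \<le> C"
proof -
  obtain C where C: "C > 0" "\<And>F x. finite F \<Longrightarrow> (\<Sum>g\<in>F. term_at g 1 0 x) \<le> C"
    using finite_sums_bounded by blast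
  have "T x \<le> C" for x
    unfolding T_eq using T_summable C(2) by (rule infsum_le_finite_sums)
  moreover have "T x \<ge> 0" for x
    unfolding T_eq by (intro infsum_nonneg term_at_nonneg)
  ultimately show thesis using C that[of C] by simp
qed

section \<open>Symmetries and the functional equation\<close>
lemma T_even: "T (- x) = T x"
proof -
  have "T (- x) = (\<Sum>\<^sub>\<infinity>g. term_at (g * negation_elt) (-1) 0 x)"
    by (simp add: T_eq flip: term_at_negation)
  also have "\<dots> = (\<Sum>\<^sub>\<infinity>g. term_at g (-1) 0 x)"
    by (rule infsum_reindex_bij_betw[OF bij_right_mult])
  also have "\<dots> = (\<Sum>\<^sub>\<infinity>g. term_at g 1 0 x)"
    using form_slash_scale[of "-1" r P L _ 1 0] by (simp add: term_at_def)
  finally show ?thesis by (simp add: T_eq)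
qed

lemma T_periodic: "T (x + 1) = T x"
proof -
  have "T (x + 1) = (\<Sum>\<^sub>\<infinity>g. term_at (g * translation_elt) 1 0 x)"
    by (simp add: T_eq flip: term_at_translation)
  also have "\<dots> = (\<Sum>\<^sub>\<infinity>g. term_at g 1 0 x)"
    by (rule infsum_reindex_bij_betw[OF bij_right_mult])
  finally show ?thesis by (simp add: T_eq)
qed

text \<open>The first sum on the right is the weighted sum seen from the cusp \<open>(0, 1)\<close>.\<close>
lemma T_split:
  "(\<lambda>g. term_at g 0 1 x) summable_on UNIV"
  "T x = (\<Sum>\<^sub>\<infinity>g. term_at g 0 1 x) + R x"
proof -
  let ?f = "\<lambda>g. if g \<in> positive_at_zero r P then lam g x * signed_slash r P g x else 0"
  have f: "?f summable_on UNIV"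
    using remainder_summable[of x] by (subst summable_on_cong_neutral) auto
  have "(\<lambda>g. term_at g 1 0 x + (- ?f g)) summable_on UNIV"
    using T_summable f by (intro summable_on_add summable_on_uminus[THEN iffD2])
  then show s: "(\<lambda>g. term_at g 0 1 x) summable_on UNIV"
    by (simp add: term_at_zero[of _ x])
  have "R x = (\<Sum>\<^sub>\<infinity>g. ?f g)"
    unfolding remainder_sum_def by (rule infsum_cong_neutral) auto
  then show "T x = (\<Sum>\<^sub>\<infinity>g. term_at g 0 1 x) + R x"
    unfolding T_eq term_at_zero[of _ x] using infsum_add[OF s f] by simp
qed

lemma T_functional_equation:
  assumes "x \<noteq> 0"
  shows "T x = x ^ (2 * r) * T (1 / x) + R x"
proof -
  have "x ^ (2 * r) * T (1 / x) = (\<Sum>\<^sub>\<infinity>g. x ^ (2 * r) * term_at g 1 0 (1 / x))"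
    unfolding T_eq using T_summable by (simp add: infsum_cmult_right)
  also have "\<dots> = (\<Sum>\<^sub>\<infinity>g. term_at (g * inversion_elt) 0 1 x)"
    by (simp add: term_at_inversion[OF assms])
  also have "\<dots> = (\<Sum>\<^sub>\<infinity>g. term_at g 0 1 x)"
    by (rule infsum_reindex_bij_betw[OF bij_right_mult])
  finally show ?thesis using T_split(2)[of x] by simp
qed

text \<open>At \<open>x = 0\<close> the cusp \<open>(0, 1)\<close> is the point itself, so every term seen from there is zero.\<close>
lemma T_zero: "T 0 = R 0"
proof -
  have "term_at g 0 1 0 = 0" for g
    by (simp add: term_at_def sgn_if)
  then show ?thesis using T_split(2)[of 0] by simp
qed

section \<open>Continuity by contraction of the oscillation\<close>
lemma R_tendsto: "(R \<longlongrightarrow> R x) (nhds x)"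
  using remainder_continuous
  by (metis UNIV_I continuous_on_eq_continuous_at isCont_def open_UNIV tendsto_at_iff_tendsto_nhds)

text \<open>After translation \<open>|x| \<le> 1/2\<close>, so by the functional equation the variation \<open>M\<close> near \<open>1/x\<close>
  contributes at most \<open>M / 4\<close> near \<open>x\<close>. The remainder and the factor \<open>y\<^sup>2\<^sup>r\<close>, being continuous,
  contribute at most \<open>M / 8\<close> each. At \<open>x = 0\<close> there is no point \<open>1/x\<close>; there boundedness and
  \<open>T(0) = R(0)\<close> replace the hypothesis.\<close>
lemma T_oscillation_halves:
  assumes M: "M > 0" and osc: "\<And>x. \<forall>\<^sub>F y in nhds x. \<bar>T y - T x\<bar> < M"
  shows "\<forall>\<^sub>F y in nhds x. \<bar>T y - T x\<bar> < M / 2"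
proof (rule integer_translate_induct[where Q = "\<lambda>x. \<forall>\<^sub>F y in nhds x. \<bar>T y - T x\<bar> < M / 2"])
  fix x :: real
  have "(\<forall>\<^sub>F y in nhds (x + 1). \<bar>T y - T (x + 1)\<bar> < M / 2) \<longleftrightarrow>
      (\<forall>\<^sub>F y in filtermap (\<lambda>y. y + 1) (nhds x). \<bar>T y - T (x + 1)\<bar> < M / 2)"
    by (simp add: filtermap_nhds_shift[of "-1", simplified])
  also have "\<dots> \<longleftrightarrow> (\<forall>\<^sub>F y in nhds x. \<bar>T y - T x\<bar> < M / 2)"
    by (simp add: eventually_filtermap T_periodic)
  finally show "(\<forall>\<^sub>F y in nhds (x + 1). \<bar>T y - T (x + 1)\<bar> < M / 2) \<longleftrightarrow>
      (\<forall>\<^sub>F y in nhds x. \<bar>T y - T x\<bar> < M / 2)" .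
next
  fix x :: real assume x: "\<bar>x\<bar> \<le> 1 / 2"
  obtain C where C: "C > 0" "\<And>x. \<bar>T x\<bar> \<le> C" using T_bounded by blast
  have M8: "M / 8 > 0" using M by simp
  have R: "\<forall>\<^sub>F y in nhds x. \<bar>R y - R x\<bar> < M / 8"
    using tendstoD[OF R_tendsto M8] by (simp add: dist_real_def)
  have "((\<lambda>y. y ^ (2 * r)) \<longlongrightarrow> x ^ (2 * r)) (nhds x)"
    by (intro tendsto_intros filterlim_ident)
  then have pw: "\<forall>\<^sub>F y in nhds x. \<bar>y ^ (2 * r) - x ^ (2 * r)\<bar> < M / 8 / C"
    using tendstoD[of "\<lambda>y. y ^ (2 * r)" _ "nhds x" "M / 8 / C"] M8 C by (simp add: dist_real_def)
  have pw': "\<bar>(y ^ (2 * r) - x ^ (2 * r)) * T (1 / y)\<bar> \<le> M / 8"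
    if "\<bar>y ^ (2 * r) - x ^ (2 * r)\<bar> < M / 8 / C" for y
  proof -
    have "\<bar>(y ^ (2 * r) - x ^ (2 * r)) * T (1 / y)\<bar> \<le> (M / 8 / C) * C"
      unfolding abs_mult using that C by (intro mult_mono) auto
    then show ?thesis using C by simp
  qed
  show "\<forall>\<^sub>F y in nhds x. \<bar>T y - T x\<bar> < M / 2"
  proof (cases "x = 0")
    case True
    show ?thesis using R pw
    proof eventually_elim
      case (elim y)
      show ?case
      proof (cases "y = 0")
        case False
        have "T y - T x = y ^ (2 * r) * T (1 / y) + (R y - R x)"
          using T_functional_equation[OF False] T_zero True by simp
        moreover have "\<bar>y ^ (2 * r) * T (1 / y)\<bar> \<le> M / 8"
          using pw'[OF elim(2)] True r by (simp add: power_0_left)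
        ultimately show ?thesis using elim(1) M by linarith
      qed (use True M in simp)
    qed
  next
    case False
    have "((\<lambda>y. 1 / y) \<longlongrightarrow> 1 / x) (nhds x)"
      using False by (intro tendsto_intros filterlim_ident)
    then have "\<forall>\<^sub>F y in nhds x. \<bar>T (1 / y) - T (1 / x)\<bar> < M"
      using osc[of "1 / x"] by (rule eventually_compose_filterlim[rotated])
    with R pw t1_space_nhds[OF False] show ?thesis
    proof eventually_elim
      case (elim y)
      have "T y - T x = (R y - R x) + (y ^ (2 * r) - x ^ (2 * r)) * T (1 / y)
          + x ^ (2 * r) * (T (1 / y) - T (1 / x))"
        using T_functional_equation[OF False] T_functional_equation[OF elim(3)]
        by (simp add: algebra_simps)
      moreover have "\<bar>x ^ (2 * r) * (T (1 / y) - T (1 / x))\<bar> \<le> 1 / 4 * M"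
        unfolding abs_mult using half_power_bound[OF x] elim(4)
        by (intro mult_mono) (auto simp: power_mult)
      ultimately show ?case using elim(1) pw'[OF elim(2)] M by linarith
    qed
  qed
qed

lemma T_continuous: "continuous_on UNIV T"
proof -
  obtain C where C: "C > 0" "\<And>x. \<bar>T x\<bar> \<le> C" using T_bounded by blast
  have osc: "\<forall>\<^sub>F y in nhds x. \<bar>T y - T x\<bar> < 3 * C / 2 ^ n" for n x
  proof (induction n arbitrary: x)
    case 0
    have "\<bar>T y - T x\<bar> < 3 * C" for y
      using C(1) C(2)[of x] C(2)[of y] by linarith
    then show ?case by simp
  next
    case (Suc n)
    from T_oscillation_halves[OF _ Suc] C show ?case by (simp add: mult.commute)
  qed
  have "isCont T x" for x
    unfolding isCont_def tendsto_at_iff_tendsto_nhds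
  proof (rule tendstoI)
    fix e :: real assume "e > 0"
    then have "e / (3 * C) > 0" using C by simp
    then obtain n where "(1 / 2) ^ n < e / (3 * C)"
      using real_arch_pow_inv[of "e / (3 * C)" "1 / 2"] by auto
    then have "3 * C / 2 ^ n < e" using C by (simp add: field_simps power_one_over)
    with osc[of x n] show "\<forall>\<^sub>F y in nhds x. dist (T y) (T x) < e"
      by (auto simp: dist_real_def elim: eventually_mono)
  qed
  then show ?thesis by (simp add: continuous_at_imp_continuous_on)
qed

end

theorem theorem1:
  fixes r :: nat and P :: "real \<Rightarrow> real" and \<alpha> \<beta> L :: real
    and lam :: "pgl2z \<Rightarrow> real \<Rightarrow> real"
  assumes r: "r \<ge> 1"
    and P_cont: "continuous_on UNIV P"
    and P_pieces: "piecewise_poly (2 * r) P"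
    and roots: "\<alpha> < \<beta>" "\<alpha> \<notin> \<rat>" "\<beta> \<notin> \<rat>" "{x. P x = 0} = {\<alpha>, \<beta>}"
    and P_pos: "\<And>x. x \<in> {\<alpha><..<\<beta>} \<Longrightarrow> P x > 0"
    and P_neg: "\<And>x. x \<notin> {\<alpha>..\<beta>} \<Longrightarrow> P x < 0"
    and L_neg: "L < 0"
    and lim_bot: "((\<lambda>x. P x / x ^ (2 * r)) \<longlongrightarrow> L) at_bot"
    and lim_top: "((\<lambda>x. P x / x ^ (2 * r)) \<longlongrightarrow> L) at_top"
    and lam_nonneg: "\<And>g x. lam g x \<ge> 0"
    and compat: "\<And>s g x. s \<in> {translation_elt, negation_elt, inversion_elt} \<Longrightarrow>
        \<not> maps_to_infinity s x \<Longrightarrow> lam (g * inverse s) (moebius_map s x) = lam g x"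
    and prop1: "\<And>g. continuous_on UNIV (\<lambda>x. lam g x * signed_slash r P g x)"
    and prop2: "\<And>g. locally_uniformly_summable
        (\<lambda>d x. lam (d * g) x * \<bar>slash r P g x\<bar>) (stabiliser r P)"
    and prop3: "finite (stabiliser_coset r P ` {g. signed_slash r P g 0 > 0})"
  shows "(\<forall>x. (\<lambda>g. lam g x * pos_part (signed_slash r P g) x) summable_on UNIV) \<and>
    (\<forall>x. weighted_sum r P lam (- x) = weighted_sum r P lam x) \<and>
    (\<forall>x. weighted_sum r P lam (x + 1) = weighted_sum r P lam x) \<and>
    continuous_on UNIV (weighted_sum r P lam) \<and>
    (\<forall>x. (\<lambda>g. lam g x * signed_slash r P g x) summable_on positive_at_zero r P) \<and>
    (\<forall>x. x \<noteq> 0 \<longrightarrow>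
      x ^ (2 * r) * weighted_sum r P lam (1 / x) - weighted_sum r P lam x
        = - remainder_sum r P lam x)"
proof -
  have rational_nonroot: "P q \<noteq> 0" if "q \<in> \<rat>" for q
  proof
    assume "P q = 0"
    then have "q \<in> {\<alpha>, \<beta>}" unfolding roots(4)[symmetric] by simp
    with that roots(2,3) show False by auto
  qed
  interpret weighted_sum_data r P L lam
    by unfold_locales (fact P_cont rational_nonroot L_neg lim_bot lim_top r lam_nonneg compat
        prop1 prop2 prop3)+
  have "x ^ (2 * r) * T (1 / x) - T x = - R x" if "x \<noteq> 0" for x
    using T_functional_equation[OF that] by simp
  then show ?thesis
    using T_summable T_even T_periodic T_continuous remainder_summable
    by (simp add: term_at_infinity)
qed

end
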